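(* Let $L$ be a residuated lattice. Suppose that there exists a system of filters $\mathcal F$ of $L$ such that $\{1\}\notin\mathcal F$ and $\bigcap_{F\in\mathcal F}F=\{1\}$. Then $\mathcal T_{\mathcal F}$ is a non-discrete Hausdorff linear topology on $L$.
   Context: A residuated lattice is an algebra $(L,\wedge,\vee,\odot,\rightarrow,0,1)$ such that $(L,\wedge,\vee,0,1)$ is a bounded lattice, $(L,\odot,1)$ is a commutative monoid, and $x\odot y\leq z$ iff $x\leq y\rightarrow z$ for all $x,y,z\in L$. A filter of $L$ is a nonempty subset $F\subseteq L$ closed under $\odot$ and upward closed. For a filter $F$, $x/F=\{y\in L:(x\to y)\odot(y\to x)\in F\}$. A system of filters of $L$ is a nonempty family $\mathcal F$ of filters that is down-directed under inclusion: for all $F,G\in\mathcal F$ there is $H\in\mathcal F$ with $H\subseteq F\cap G$. It induces the topology $\mathcal T_{\mathcal F}=\{U\subseteq L:\forall x\in U\ \exists F\in\mathcal F,\ x/F\subseteq U\}$. A topology on $L$ is linear if it has a base $\beta$ such that, for all $B\in\beta$, $B$ is a filter if and only if $1\in B$. *)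

theory Defs
  imports "HOL-Analysis.Analysis"
begin

text \<open>
  The underlying set of the residuated lattice is the whole type. Meet, join and the bounds 0 and 1
  are \<^const>\<open>inf\<close>, \<^const>\<open>sup\<close>, \<^const>\<open>bot\<close> and \<^const>\<open>top\<close>; the monoid operation is \<^const>\<open>times\<close>, whose unit
  is identified with the top element by the axiom \<open>one_eq_top\<close>.
\<close>

class residuated_lattice = bounded_lattice + comm_monoid_mult +
  fixes residuum :: "'a \<Rightarrow> 'a \<Rightarrow> 'a"  (infixr \<open>\<leadsto>\<close> 60)
  assumes one_eq_top: "1 = top"
    and residuation: "x * y \<le> z \<longleftrightarrow> x \<le> y \<leadsto> z"

definition lattice_filter :: "'a::residuated_lattice set \<Rightarrow> bool" where
  "lattice_filter F \<longleftrightarrow>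
     F \<noteq> {} \<and> (\<forall>x\<in>F. \<forall>y\<in>F. x * y \<in> F) \<and> (\<forall>x\<in>F. \<forall>y. x \<le> y \<longrightarrow> y \<in> F)"

definition filter_class :: "'a::residuated_lattice \<Rightarrow> 'a set \<Rightarrow> 'a set" where
  "filter_class x F = {y. (x \<leadsto> y) * (y \<leadsto> x) \<in> F}"

definition filter_system :: "'a::residuated_lattice set set \<Rightarrow> bool" where
  "filter_system \<F> \<longleftrightarrow>
     \<F> \<noteq> {} \<and> (\<forall>F\<in>\<F>. lattice_filter F) \<and> (\<forall>F\<in>\<F>. \<forall>G\<in>\<F>. \<exists>H\<in>\<F>. H \<subseteq> F \<inter> G)"

definition filter_open :: "'a::residuated_lattice set set \<Rightarrow> 'a set \<Rightarrow> bool" where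
  "filter_open \<F> U \<longleftrightarrow> (\<forall>x\<in>U. \<exists>F\<in>\<F>. filter_class x F \<subseteq> U)"

text \<open>
  \<^const>\<open>topology\<close> is meaningful only if \<^term>\<open>istopology (filter_open \<F>)\<close> holds, and a
  value of type \<^typ>\<open>'a topology\<close> need not have all of \<^typ>\<open>'a\<close> as its space.
  Statements about this topology therefore assert both facts explicitly.
\<close>

definition filter_topology :: "'a::residuated_lattice set set \<Rightarrow> 'a topology" where
  "filter_topology \<F> = topology (filter_open \<F>)"

definition linear_topology :: "'a::residuated_lattice topology \<Rightarrow> bool" where
  "linear_topology T \<longleftrightarrow>
     (\<exists>\<beta>. openin T = arbitrary union_of (\<lambda>B. B \<in> \<beta>) \<and> (\<forall>B\<in>\<beta>. lattice_filter B \<longleftrightarrow> 1 \<in> B))"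

end

theory Submission
  imports Defs
begin

text \<open>
  For a filter \<open>F\<close> the sets \<open>x/F\<close> partition \<open>L\<close>, and \<open>1/F = F\<close>. The classes modulo members of the
  system therefore form a base of clopen sets, and a class contains 1 only if it equals \<open>F\<close>, which
  gives linearity. If \<open>{1}\<close> were open, it would contain some \<open>F = 1/F\<close> of the system. If \<open>x\<close> and \<open>y\<close>
  lie in a common class for every \<open>F\<close>, then \<open>(x \<rightarrow> y) \<odot> (y \<rightarrow> x)\<close> lies in the intersection \<open>{1}\<close>, so
  \<open>x = y\<close>; otherwise two disjoint classes separate them.
\<close>

lemma le_one: "x \<le> (1::'a::residuated_lattice)"
  by (simp add: one_eq_top)

text \<open>Monotonicity is not an axiom. It follows from residuation, since
  \<open>b \<le> c \<leadsto> b * c\<close> is the unit of the adjunction between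
  \<open>_ * c\<close> and \<open>c \<leadsto> _\<close>.\<close>

lemma times_right_mono:
  fixes a b c :: "'a::residuated_lattice"
  assumes "a \<le> b"
  shows "a * c \<le> b * c"
proof -
  have "b \<le> c \<leadsto> b * c"
    by (simp flip: residuation)
  with assms have "a \<le> c \<leadsto> b * c"
    by (rule order_trans)
  then show ?thesis
    by (simp add: residuation)
qed

lemma times_mono:
  fixes a b c d :: "'a::residuated_lattice"
  assumes "a \<le> b" "c \<le> d"
  shows "a * c \<le> b * d"
  using times_right_mono[OF assms(1), of c] times_right_mono[OF assms(2), of b]
  by (simp add: mult.commute)

lemma times_le_left: "x * y \<le> (x::'a::residuated_lattice)"
  using times_mono[OF order_refl le_one, of x y] by simp

lemma residuum_times_le: "(x \<leadsto> y) * x \<le> (y::'a::residuated_lattice)"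
  by (simp add: residuation)

text \<open>By residuation it suffices to multiply the left side by \<open>x\<close> and apply
  \<open>residuum_times_le\<close> twice. This is the source of transitivity for classes modulo a
  filter.\<close>

lemma residuum_trans: "(x \<leadsto> y) * (y \<leadsto> z) \<le> (x::'a::residuated_lattice) \<leadsto> z"
proof -
  have "(x \<leadsto> y) * (y \<leadsto> z) * x = (y \<leadsto> z) * ((x \<leadsto> y) * x)"
    by (simp add: ac_simps)
  also have "\<dots> \<le> (y \<leadsto> z) * y"
    by (intro times_mono order_refl residuum_times_le)
  also have "\<dots> \<le> z"
    by (rule residuum_times_le)
  finally show ?thesis
    by (simp add: residuation)
qed

lemma residuum_self [simp]: "x \<leadsto> x = (1::'a::residuated_lattice)"
  by (intro antisym le_one) (simp flip: residuation)

lemma residuum_one [simp]: "x \<leadsto> 1 = (1::'a::residuated_lattice)"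
  by (intro antisym le_one) (simp add: le_one flip: residuation)

lemma one_residuum [simp]: "1 \<leadsto> x = (x::'a::residuated_lattice)"
  by (intro antisym) (use residuum_times_le[of 1 x] in simp, simp flip: residuation)

text \<open>A product lies below each factor, so both residua are 1, and
  \<open>1 \<le> x \<leadsto> y\<close> residuates to \<open>x \<le> y\<close>.\<close>

lemma residuum_times_eq_one:
  fixes x y :: "'a::residuated_lattice"
  assumes "(x \<leadsto> y) * (y \<leadsto> x) = 1"
  shows "x = y"
proof (rule antisym)
  show "x \<le> y"
    using times_le_left[of "x \<leadsto> y" "y \<leadsto> x"] assms by (simp flip: residuation)
  show "y \<le> x"
    using times_le_left[of "y \<leadsto> x" "x \<leadsto> y"] assms by (simp add: mult.commute flip: residuation)
qed

lemma lattice_filter_one: "lattice_filter F \<Longrightarrow> 1 \<in> F"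
  unfolding lattice_filter_def using le_one by blast

lemma filter_class_refl: "lattice_filter F \<Longrightarrow> x \<in> filter_class x F"
  by (simp add: filter_class_def lattice_filter_one)

lemma filter_class_sym: "y \<in> filter_class x F \<longleftrightarrow> x \<in> filter_class y F"
  by (simp add: filter_class_def mult.commute)

lemma filter_class_trans:
  assumes F: "lattice_filter F" and xy: "y \<in> filter_class x F" and yz: "z \<in> filter_class y F"
  shows "z \<in> filter_class x F"
proof -
  \<comment> \<open>Regrouping pairs the residua that compose, one pair from \<open>x\<close> to
    \<open>z\<close> and one back. The left side is in \<open>F\<close> by closure under products,
    hence so is the larger right side.\<close>
  have "((x \<leadsto> y) * (y \<leadsto> x)) * ((y \<leadsto> z) * (z \<leadsto> y)) =
        ((x \<leadsto> y) * (y \<leadsto> z)) * ((z \<leadsto> y) * (y \<leadsto> x))"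
    by (simp add: ac_simps)
  also have "\<dots> \<le> (x \<leadsto> z) * (z \<leadsto> x)"
    by (intro times_mono residuum_trans)
  finally show ?thesis
    using F xy yz unfolding lattice_filter_def filter_class_def mem_Collect_eq by metis
qed

lemma filter_class_eq:
  assumes "lattice_filter F" "y \<in> filter_class x F"
  shows "filter_class y F = filter_class x F"
proof -
  have "x \<in> filter_class y F"
    using assms(2) by (simp add: filter_class_sym)
  then show ?thesis
    using filter_class_trans[OF assms(1)] assms(2) by blast
qed

lemma filter_class_one [simp]: "filter_class 1 F = F"
  by (simp add: filter_class_def)

lemma filter_class_mono: "F \<subseteq> G \<Longrightarrow> filter_class x F \<subseteq> filter_class x G"
  by (auto simp: filter_class_def)

lemma filter_class_is_filter_iff:
  assumes "lattice_filter F"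
  shows "lattice_filter (filter_class x F) \<longleftrightarrow> 1 \<in> filter_class x F"
  using filter_class_eq[OF assms, of 1 x] lattice_filter_one assms by auto

context
  fixes \<F> :: "'a::residuated_lattice set set"
  assumes system: "filter_system \<F>"
begin

lemma filter_system_filter: "F \<in> \<F> \<Longrightarrow> lattice_filter F"
  using system by (simp add: filter_system_def)

lemma istopology_filter_open: "istopology (filter_open \<F>)"
  unfolding istopology_def
proof (intro conjI allI impI)
  fix S T assume S: "filter_open \<F> S" and T: "filter_open \<F> T"
  show "filter_open \<F> (S \<inter> T)"
    unfolding filter_open_def
  proof
    fix x assume "x \<in> S \<inter> T"
    then obtain F G where "F \<in> \<F>" "filter_class x F \<subseteq> S" "G \<in> \<F>" "filter_class x G \<subseteq> T"
      using S T unfolding filter_open_def by blast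
    \<comment> \<open>Down-directedness gives \<open>H\<close>; a smaller filter has smaller
      classes, so \<open>x/H\<close> fits into both sets.\<close>
    moreover from this obtain H where "H \<in> \<F>" "H \<subseteq> F" "H \<subseteq> G"
      using system unfolding filter_system_def by (meson le_inf_iff)
    ultimately show "\<exists>H\<in>\<F>. filter_class x H \<subseteq> S \<inter> T"
      using filter_class_mono by (meson le_inf_iff order_trans)
  qed
next
  fix \<K> assume "\<forall>K\<in>\<K>. filter_open \<F> K"
  then show "filter_open \<F> (\<Union>\<K>)"
    unfolding filter_open_def by (meson Union_iff Union_upper order_trans)
qed

lemma openin_filter_topology: "openin (filter_topology \<F>) = filter_open \<F>"
  by (simp add: filter_topology_def topology_inverse' istopology_filter_open)

lemma topspace_filter_topology: "topspace (filter_topology \<F>) = UNIV"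
proof -
  have "filter_open \<F> UNIV"
    using system by (auto simp: filter_open_def filter_system_def)
  then show ?thesis
    using openin_subset[of "filter_topology \<F>" UNIV] by (auto simp: openin_filter_topology)
qed

text \<open>The same \<open>F\<close> serves at every point \<open>y\<close> of the class, because
  \<open>y/F = x/F\<close>.\<close>

lemma filter_open_filter_class:
  assumes "F \<in> \<F>"
  shows "filter_open \<F> (filter_class x F)"
  unfolding filter_open_def
  using assms filter_class_eq[OF filter_system_filter[OF assms]] by (intro ballI bexI[of _ F]) auto

lemma linear_filter_topology: "linear_topology (filter_topology \<F>)"
  unfolding linear_topology_def
proof (intro exI conjI ballI)
  let ?\<beta> = "{filter_class x F | x F. F \<in> \<F>}"
  show "openin (filter_topology \<F>) = arbitrary union_of (\<lambda>B. B \<in> ?\<beta>)"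
    unfolding openin_topology_base_unique
  proof (intro conjI allI impI)
    fix V assume "V \<in> ?\<beta>"
    then show "openin (filter_topology \<F>) V"
      using filter_open_filter_class by (auto simp: openin_filter_topology)
  next
    fix U x assume "openin (filter_topology \<F>) U \<and> x \<in> U"
    then obtain F where "F \<in> \<F>" "filter_class x F \<subseteq> U"
      by (auto simp: openin_filter_topology filter_open_def)
    then show "\<exists>V. V \<in> ?\<beta> \<and> x \<in> V \<and> V \<subseteq> U"
      using filter_class_refl filter_system_filter by blast
  qed
  fix B assume "B \<in> ?\<beta>"
  then show "lattice_filter B \<longleftrightarrow> 1 \<in> B"
    using filter_class_is_filter_iff filter_system_filter by blast
qed

lemma filter_topology_not_discrete:
  assumes "{1} \<notin> \<F>"
  shows "filter_topology \<F> \<noteq> discrete_topology UNIV"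
proof
  assume "filter_topology \<F> = discrete_topology UNIV"
  then have "filter_open \<F> {1}"
    by (simp flip: openin_filter_topology)
  \<comment> \<open>Openness is tested at the point 1, where the class \<open>1/F\<close> is
    \<open>F\<close> itself.\<close>
  then obtain F where "F \<in> \<F>" "F \<subseteq> {1}"
    by (auto simp: filter_open_def)
  moreover from this have "1 \<in> F"
    by (simp add: filter_system_filter lattice_filter_one)
  ultimately show False
    using assms by (metis empty_iff subset_singletonD)
qed

lemma Hausdorff_filter_topology:
  assumes "\<Inter>\<F> = {1}"
  shows "Hausdorff_space (filter_topology \<F>)"
  unfolding Hausdorff_space_def topspace_filter_topology openin_filter_topology
proof (intro allI impI)
  fix x y :: 'a assume "x \<in> UNIV \<and> y \<in> UNIV \<and> x \<noteq> y"
  \<comment> \<open>The intersection contains only 1, and this product is 1 only when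
    \<open>x = y\<close>; so some single \<open>F\<close> already omits it.\<close>
  then have "(x \<leadsto> y) * (y \<leadsto> x) \<notin> \<Inter>\<F>"
    using assms residuum_times_eq_one by auto
  then obtain F where F: "F \<in> \<F>" and "y \<notin> filter_class x F"
    by (auto simp: filter_class_def)
  \<comment> \<open>A common point of the two classes would, by symmetry and transitivity, put
    \<open>y\<close> into \<open>x/F\<close>.\<close>
  then have "disjnt (filter_class x F) (filter_class y F)"
    using filter_class_sym filter_class_trans[OF filter_system_filter[OF F]]
    unfolding disjnt_iff by metis
  then show "\<exists>U V. filter_open \<F> U \<and> filter_open \<F> V \<and> x \<in> U \<and> y \<in> V \<and> disjnt U V"
    using F filter_open_filter_class filter_class_refl filter_system_filter by blast
qed

end

theorem theorem5p18:
  fixes \<F> :: "'a::residuated_lattice set set"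
  assumes "filter_system \<F>"
    and "{1} \<notin> \<F>"
    and "\<Inter>\<F> = {1}"
  shows "istopology (filter_open \<F>) \<and>
         topspace (filter_topology \<F>) = UNIV \<and>
         filter_topology \<F> \<noteq> discrete_topology UNIV \<and>
         Hausdorff_space (filter_topology \<F>) \<and>
         linear_topology (filter_topology \<F>)"
  using assms by (simp add: istopology_filter_open topspace_filter_topology
      filter_topology_not_discrete Hausdorff_filter_topology linear_filter_topology)

end
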